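(* Let $q$ be a prime power, $n\ge 2$, $\sigma$ a generator of $\mathrm{Gal}(\mathbb{F}_{q^n}/\mathbb{F}_q)$, and $L(x)=ax+bx^{\sigma}+cx^{\sigma^2}\in\mathbb{F}_{q^n}[x]$ with $ac\neq 0$. Let $u$ and the sequence $(G_k)$ be as in the context. Then: (i) $L$ has $q^2$ roots in $\mathbb{F}_{q^n}$ if and only if $G_{n-1}=0$ and $N(b/c)G_n=1$; (ii) $L$ has $q$ roots in $\mathbb{F}_{q^n}$ if and only if $1-N(b/c)\big(G_n+G_n^{\sigma}+G_{n-1}^{\sigma}\big)+N(a/c)=0$ and the conditions of (i) are not satisfied; (iii) $L$ has exactly $1$ root in $\mathbb{F}_{q^n}$ if and only if $1-N(b/c)\big(G_n+G_n^{\sigma}+G_{n-1}^{\sigma}\big)+N(a/c)\neq 0$.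
   Context: $N(x)=x^{1+\sigma+\dots+\sigma^{n-1}}$ is the norm $\mathbb{F}_{q^n}\to\mathbb{F}_q$. Set $u=\frac{a^{\sigma}c}{b^{\sigma+1}}$ and define $G_0=1$, $G_1=-1$, and $G_k=-G_{k-1}-u^{\sigma^{k-2}}G_{k-2}$ for $k\ge2$ (so $G_2=1-u$, $G_3=u^\sigma+u-1$, ...). Roots are counted in $\mathbb{F}_{q^n}$. Convention of the paper: $u$ and the $G_k$ are handled as formal expressions in $a,b,c$ and their $\sigma$-conjugates; when $b\neq0$ all expressions are literal, and in general every expression is evaluated only after clearing denominators involving $b$. In particular $N(b/c)G_n$ and $N(b/c)(G_n+G_n^\sigma+G_{n-1}^\sigma)$ are polynomial expressions in $a,b,1/c$ and their conjugates, and the condition $G_{n-1}=0$ is read as the vanishing of the polynomial expression $(b/c)^{1+\sigma+\dots+\sigma^{n-2}}G_{n-1}$. *)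

theory Defs
  imports
    "HOL-Library.Poly_Mapping"
    "HOL-Computational_Algebra.Computational_Algebra"
    "HOL-Number_Theory.Prime_Powers"
begin

section \<open>The Galois group of a finite field over its subfield of order q\<close>

definition Gal :: "nat \<Rightarrow> ('a::field \<Rightarrow> 'a) set" where
  "Gal q = {\<tau>. bij \<tau> \<and> \<tau> 1 = 1 \<and>
             (\<forall>x y. \<tau> (x + y) = \<tau> x + \<tau> y) \<and> (\<forall>x y. \<tau> (x * y) = \<tau> x * \<tau> y) \<and>
             (\<forall>x. x ^ q = x \<longrightarrow> \<tau> x = x)}"

text \<open>The group is finite, so nonnegative powers of an element exhaust the subgroup it generates.\<close>

definition generates_Gal :: "nat \<Rightarrow> ('a::field \<Rightarrow> 'a) \<Rightarrow> bool" where
  "generates_Gal q \<sigma> \<longleftrightarrow> \<sigma> \<in> Gal q \<and> Gal q = {\<sigma> ^^ k |k. True}"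


section \<open>Expressions in conjugates\<close>

text \<open>
  An expression is represented together with its conjugates, as the sequence whose entry \<open>i\<close>
  is the result of applying \<open>\<sigma>\<close> to it \<open>i\<close> times. Applying \<open>\<sigma>\<close> to an expression is then a shift of
  the sequences it is built from. The definitions are generic in the field, so that they apply
  both to literal elements and to formal rational functions.
\<close>

definition conj_shift :: "(nat \<Rightarrow> 'f) \<Rightarrow> nat \<Rightarrow> 'f" where
  "conj_shift x = (\<lambda>i. x (Suc i))"

text \<open>The product of the first \<open>k\<close> conjugates; for \<open>k = n\<close> this is the norm.\<close>

definition conj_prod :: "(nat \<Rightarrow> 'f::comm_monoid_mult) \<Rightarrow> nat \<Rightarrow> 'f" where
  "conj_prod x k = (\<Prod>i<k. x i)"

definition u_expr :: "(nat \<Rightarrow> 'f::field) \<Rightarrow> (nat \<Rightarrow> 'f) \<Rightarrow> (nat \<Rightarrow> 'f) \<Rightarrow> nat \<Rightarrow> 'f" where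
  "u_expr a b c i = a (Suc i) * c i / (b (Suc i) * b i)"

fun G :: "(nat \<Rightarrow> 'f::field) \<Rightarrow> nat \<Rightarrow> 'f" where
  "G u 0 = 1"
| "G u (Suc 0) = - 1"
| "G u (Suc (Suc k)) = - G u (Suc k) - u k * G u k"


section \<open>Formal expressions in the conjugates of b\<close>

text \<open>
  Multivariate polynomials: the indeterminate with index \<open>i\<close> stands for the \<open>i\<close>-th conjugate
  of \<open>b\<close>.
\<close>

type_synonym 'a bpoly = "(nat \<Rightarrow>\<^sub>0 nat) \<Rightarrow>\<^sub>0 'a"

definition bConst :: "'a::zero \<Rightarrow> 'a bpoly" where
  "bConst r = Poly_Mapping.single 0 r"

definition bVar :: "nat \<Rightarrow> 'a::zero_neq_one bpoly" where
  "bVar i = Poly_Mapping.single (Poly_Mapping.single i 1) 1"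

definition beval :: "(nat \<Rightarrow> 'a::comm_semiring_1) \<Rightarrow> 'a bpoly \<Rightarrow> 'a" where
  "beval x p = (\<Sum>m\<in>Poly_Mapping.keys p.
     Poly_Mapping.lookup p m * (\<Prod>i\<in>Poly_Mapping.keys m. x i ^ Poly_Mapping.lookup m i))"

definition orbit :: "('a \<Rightarrow> 'a) \<Rightarrow> 'a \<Rightarrow> nat \<Rightarrow> 'a" where
  "orbit \<sigma> x i = (\<sigma> ^^ i) x"

definition formal_const :: "('a::field \<Rightarrow> 'a) \<Rightarrow> 'a \<Rightarrow> nat \<Rightarrow> 'a bpoly fract" where
  "formal_const \<sigma> x i = to_fract (bConst (orbit \<sigma> x i))"

text \<open>Indices are taken modulo \<open>n\<close> because \<open>\<sigma>\<close> has order \<open>n\<close>.\<close>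

definition formal_b :: "nat \<Rightarrow> nat \<Rightarrow> 'a::field bpoly fract" where
  "formal_b n i = to_fract (bVar (i mod n))"

definition formal_u :: "('a::field \<Rightarrow> 'a) \<Rightarrow> nat \<Rightarrow> 'a \<Rightarrow> 'a \<Rightarrow> nat \<Rightarrow> 'a bpoly fract" where
  "formal_u \<sigma> n a c = u_expr (formal_const \<sigma> a) (formal_b n) (formal_const \<sigma> c)"

definition formal_b_over_c :: "('a::field \<Rightarrow> 'a) \<Rightarrow> nat \<Rightarrow> 'a \<Rightarrow> nat \<Rightarrow> 'a bpoly fract" where
  "formal_b_over_c \<sigma> n c i = formal_b n i / formal_const \<sigma> c i"

text \<open>
  The value at \<open>b\<close> of a formal rational expression whose denominators in the conjugates of \<open>b\<close>
  cancel. That they do cancel in the expressions of interest is shown below.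
\<close>

definition cleared_value :: "('a::field \<Rightarrow> 'a) \<Rightarrow> 'a \<Rightarrow> 'a bpoly fract \<Rightarrow> 'a" where
  "cleared_value \<sigma> b r = beval (orbit \<sigma> b) (THE p. to_fract p = r)"


section \<open>Clearing denominators, and agreement with the literal reading for nonzero b\<close>

lemma cleared_value_to_fract: "cleared_value \<sigma> b (to_fract p) = beval (orbit \<sigma> b) p"
  by (simp add: cleared_value_def)

lemma bConst_simps [simp]:
  fixes r s :: "'a::comm_ring_1"
  shows "bConst (0::'a) = 0" "bConst (1::'a) = 1"
    "bConst (r * s) = bConst r * bConst s"
  by (simp_all add: bConst_def mult_single)

lemma beval_superset:
  assumes "finite S" "Poly_Mapping.keys p \<subseteq> S"
  shows "beval x p = (\<Sum>m\<in>S.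
     Poly_Mapping.lookup p m * (\<Prod>i\<in>Poly_Mapping.keys m. x i ^ Poly_Mapping.lookup m i))"
  unfolding beval_def
  by (rule sum.mono_neutral_left) (use assms in \<open>auto simp: in_keys_iff\<close>)

lemma beval_0 [simp]: "beval x 0 = 0"
  by (simp add: beval_def)

lemma beval_add [simp]: "beval x (p + r) = beval x p + beval x r"
proof -
  let ?S = "Poly_Mapping.keys p \<union> Poly_Mapping.keys r"
  have "Poly_Mapping.keys (p + r) \<subseteq> ?S" by (rule Poly_Mapping.keys_add)
  then show ?thesis
    by (simp add: beval_superset [of ?S] lookup_add distrib_right sum.distrib)
qed

lemma beval_single:
  "beval x (Poly_Mapping.single m r) =
     r * (\<Prod>i\<in>Poly_Mapping.keys m. x i ^ Poly_Mapping.lookup m i)"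
  by (cases "r = 0") (simp_all add: beval_def)

lemma beval_bConst [simp]: "beval x (bConst r) = r"
  by (simp add: bConst_def beval_single)

lemma beval_bVar [simp]: "beval x (bVar i) = x i"
  by (simp add: bVar_def beval_single)

lemma beval_1 [simp]: "beval x 1 = (1 :: 'a::comm_ring_1)"
  using beval_bConst [of x "1::'a"] by (simp del: beval_bConst)

lemma monomial_add:
  fixes x :: "nat \<Rightarrow> 'a::comm_semiring_1"
  shows "(\<Prod>i\<in>Poly_Mapping.keys (m + k). x i ^ Poly_Mapping.lookup (m + k) i) =
     (\<Prod>i\<in>Poly_Mapping.keys m. x i ^ Poly_Mapping.lookup m i) *
     (\<Prod>i\<in>Poly_Mapping.keys k. x i ^ Poly_Mapping.lookup k i)"
proof -
  let ?S = "Poly_Mapping.keys m \<union> Poly_Mapping.keys k"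
  have *: "(\<Prod>i\<in>Poly_Mapping.keys l. x i ^ Poly_Mapping.lookup l i) =
      (\<Prod>i\<in>?S. x i ^ Poly_Mapping.lookup l i)" if "Poly_Mapping.keys l \<subseteq> ?S" for l
    by (rule prod.mono_neutral_left) (use that in \<open>auto simp: in_keys_iff\<close>)
  have "(\<Prod>i\<in>?S. x i ^ Poly_Mapping.lookup (m + k) i) =
      (\<Prod>i\<in>?S. x i ^ Poly_Mapping.lookup m i) * (\<Prod>i\<in>?S. x i ^ Poly_Mapping.lookup k i)"
    by (simp add: lookup_add power_add prod.distrib)
  then show ?thesis
    using * [of "m + k"] * [of m] * [of k] Poly_Mapping.keys_add [of m k] by simp
qed

lemma bpoly_induct [case_names single add]:
  assumes "\<And>m r. P (Poly_Mapping.single m r)" "\<And>p r. P p \<Longrightarrow> P r \<Longrightarrow> P (p + r)"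
  shows "P (p :: 'a::comm_ring_1 bpoly)"
proof -
  have "P (\<Sum>m\<in>S. Poly_Mapping.single m (Poly_Mapping.lookup p m))" if "finite S" for S
    using that
  proof (induction S)
    case empty
    show ?case using assms(1) [of 0 0] by simp
  qed (simp add: assms)
  moreover have "p = (\<Sum>m\<in>Poly_Mapping.keys p. Poly_Mapping.single m (Poly_Mapping.lookup p m))"
    by (rule poly_mapping_eqI)
      (simp add: lookup_sum lookup_single when_def in_keys_iff)
  ultimately show ?thesis by (metis finite_keys)
qed

lemma beval_mult [simp]:
  fixes p r :: "'a::comm_ring_1 bpoly"
  shows "beval x (p * r) = beval x p * beval x r"
proof (induction p rule: bpoly_induct)
  case (single m s)
  show ?case
  proof (induction r rule: bpoly_induct)
    case (single k t)
    show ?case by (simp add: mult_single beval_single monomial_add)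
  qed (simp add: algebra_simps)
qed (simp add: algebra_simps)

lemma beval_uminus [simp]: "beval x (- p) = - beval x (p :: 'a::comm_ring_1 bpoly)"
  by (metis add.right_inverse beval_0 beval_add minus_unique)

lemma beval_diff [simp]:
  "beval x (p - r) = beval x p - beval x (r :: 'a::comm_ring_1 bpoly)"
  using beval_add [of x p "- r"] by simp

text \<open>The polynomials obtained from the recursion after clearing denominators.\<close>

fun cleared_G :: "(nat \<Rightarrow> 'r::comm_ring_1) \<Rightarrow> (nat \<Rightarrow> 'r) \<Rightarrow> nat \<Rightarrow> 'r" where
  "cleared_G \<alpha> \<beta> 0 = 1"
| "cleared_G \<alpha> \<beta> (Suc 0) = - \<beta> 0"
| "cleared_G \<alpha> \<beta> (Suc (Suc k)) =
     - \<beta> (Suc k) * cleared_G \<alpha> \<beta> (Suc k) - \<alpha> (Suc k) * cleared_G \<alpha> \<beta> k"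

lemma conj_prod_G:
  fixes a b c :: "nat \<Rightarrow> 'f::field"
  assumes "\<And>i. b i \<noteq> 0" "\<And>i. c i \<noteq> 0"
  shows "conj_prod (\<lambda>i. b i / c i) k * G (u_expr a b c) k =
    cleared_G (\<lambda>i. a i / c i) (\<lambda>i. b i / c i) k"
proof (induction k rule: induct_nat_012)
  case (ge2 k)
  have "conj_prod (\<lambda>i. b i / c i) (Suc (Suc k)) * G (u_expr a b c) (Suc (Suc k)) =
     - (b (Suc k) / c (Suc k)) * (conj_prod (\<lambda>i. b i / c i) (Suc k) * G (u_expr a b c) (Suc k))
     - a (Suc k) / c (Suc k) * (conj_prod (\<lambda>i. b i / c i) k * G (u_expr a b c) k)"
    using assms by (simp add: conj_prod_def u_expr_def field_simps)
  then show ?case using ge2 by simp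
qed (simp_all add: conj_prod_def)

lemma conj_prod_shift:
  assumes "x n = x 0"
  shows "conj_prod (conj_shift x) n = conj_prod x n"
proof (cases n)
  case (Suc m)
  have "conj_prod x n = x 0 * conj_prod (conj_shift x) m"
    unfolding conj_prod_def conj_shift_def Suc by (rule prod.lessThan_Suc_shift)
  with Suc assms show ?thesis
    by (simp add: conj_prod_def conj_shift_def mult.commute)
qed (simp add: conj_prod_def)

lemma conj_prod_G_sum:
  fixes a b c :: "nat \<Rightarrow> 'f::field"
  assumes "\<And>i. b i \<noteq> 0" "\<And>i. c i \<noteq> 0" "b n = b 0" "c n = c 0" "n \<ge> 1"
  defines "u \<equiv> u_expr a b c" and "\<alpha> \<equiv> \<lambda>i. a i / c i" and "\<beta> \<equiv> \<lambda>i. b i / c i"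
  shows "conj_prod \<beta> n * (G u n + G (conj_shift u) n + G (conj_shift u) (n - 1)) =
    cleared_G \<alpha> \<beta> n + cleared_G (conj_shift \<alpha>) (conj_shift \<beta>) n
      + \<beta> 0 * cleared_G (conj_shift \<alpha>) (conj_shift \<beta>) (n - 1)"
proof -
  have N: "conj_prod \<beta> n = conj_prod (conj_shift \<beta>) n"
    by (rule conj_prod_shift [symmetric]) (simp add: \<beta>_def assms)
  obtain m where m: "n = Suc m" using \<open>n \<ge> 1\<close> by (cases n) auto
  have N': "conj_prod \<beta> n = \<beta> 0 * conj_prod (conj_shift \<beta>) m"
    unfolding conj_prod_def conj_shift_def m by (rule prod.lessThan_Suc_shift)
  have shift: "conj_prod (conj_shift \<beta>) k * G (conj_shift u) k =
      cleared_G (conj_shift \<alpha>) (conj_shift \<beta>) k" for k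
    using conj_prod_G [of "conj_shift b" "conj_shift c" k "conj_shift a"] assms(1,2)
    by (simp add: conj_shift_def u_def \<alpha>_def \<beta>_def u_expr_def [abs_def])
  have "conj_prod \<beta> n * G u n = cleared_G \<alpha> \<beta> n"
    using conj_prod_G [of b c n a] assms(1,2) by (simp add: u_def \<alpha>_def \<beta>_def)
  moreover have "conj_prod \<beta> n * G (conj_shift u) n = cleared_G (conj_shift \<alpha>) (conj_shift \<beta>) n"
    by (simp add: N shift)
  moreover have "conj_prod \<beta> n * G (conj_shift u) (n - 1) =
      \<beta> 0 * cleared_G (conj_shift \<alpha>) (conj_shift \<beta>) (n - 1)"
    using shift [of m] unfolding N' by (simp add: m mult.assoc)
  ultimately show ?thesis by (simp add: distrib_left)
qed

lemma cleared_G_hom: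
  fixes h :: "'r::comm_ring_1 \<Rightarrow> 's::comm_ring_1"
  assumes "h 1 = 1" "\<And>x y. h (x * y) = h x * h y" "\<And>x y. h (x - y) = h x - h y"
    "\<And>x. h (- x) = - h x"
  shows "h (cleared_G \<alpha> \<beta> k) = cleared_G (\<lambda>i. h (\<alpha> i)) (\<lambda>i. h (\<beta> i)) k"
  by (induction \<alpha> \<beta> k rule: cleared_G.induct) (simp_all add: assms)

lemma bVar_neq_0 [simp]: "bVar i \<noteq> (0 :: 'a::comm_ring_1 bpoly)"
proof
  assume "bVar i = (0 :: 'a bpoly)"
  then have "beval (\<lambda>_. 1) (bVar i) = beval (\<lambda>_. 1) (0 :: 'a bpoly)" by simp
  then show False by (simp only: beval_bVar beval_0 one_neq_zero)
qed

lemma bConst_eq_0_iff [simp]: "bConst r = 0 \<longleftrightarrow> r = (0::'a::comm_ring_1)"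
  by (metis beval_0 beval_bConst bConst_simps(1))

lemma to_fract_divide_bConst:
  fixes r :: "'a::field"
  assumes "r \<noteq> 0"
  shows "to_fract p / to_fract (bConst r) = to_fract (bConst (1 / r) * p)"
proof -
  have "to_fract (bConst r) * to_fract (bConst (1 / r) * p) = to_fract p"
    using assms
    by (simp flip: to_fract_mult mult.assoc bConst_simps(3))
  then show ?thesis
    using assms by (simp add: field_simps del: to_fract_mult)
qed

locale field_aut_order =
  fixes \<sigma> :: "'a::field \<Rightarrow> 'a" and n :: nat
  assumes one: "\<sigma> 1 = 1"
    and add: "\<sigma> (x + y) = \<sigma> x + \<sigma> y"
    and mult: "\<sigma> (x * y) = \<sigma> x * \<sigma> y"
    and period: "(\<sigma> ^^ n) x = x"
    and n_ge_2: "n \<ge> 2"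
begin

lemma zero: "\<sigma> 0 = 0"
  by (metis add add.right_neutral add_left_cancel)

lemma uminus: "\<sigma> (- x) = - \<sigma> x"
  using add [of x "- x"] by (simp add: zero eq_neg_iff_add_eq_0 add.commute)

lemma diff: "\<sigma> (x - y) = \<sigma> x - \<sigma> y"
  using add [of x "- y"] by (simp add: uminus)

lemma eq_0_iff: "\<sigma> x = 0 \<longleftrightarrow> x = 0"
proof
  assume "\<sigma> x = 0"
  show "x = 0"
  proof (rule ccontr)
    assume "x \<noteq> 0"
    then have "\<sigma> x * \<sigma> (1 / x) = 1" by (simp add: one flip: mult)
    with \<open>\<sigma> x = 0\<close> show False by simp
  qed
qed (simp add: zero)

lemma divide: "\<sigma> (x / y) = \<sigma> x / \<sigma> y"
proof (cases "y = 0")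
  case False
  then have "\<sigma> (x / y) * \<sigma> y = \<sigma> x" by (simp flip: mult)
  with False show ?thesis by (simp add: eq_0_iff field_simps)
qed (simp add: zero)

lemma orbit_0 [simp]: "orbit \<sigma> x 0 = x"
  by (simp add: orbit_def)

lemma orbit_Suc: "orbit \<sigma> x (Suc i) = \<sigma> (orbit \<sigma> x i)"
  by (simp add: orbit_def)

lemma orbit_eq_0_iff [simp]: "orbit \<sigma> x i = 0 \<longleftrightarrow> x = 0"
  by (induction i) (simp_all add: orbit_Suc eq_0_iff)

lemma orbit_divide: "orbit \<sigma> (x / y) i = orbit \<sigma> x i / orbit \<sigma> y i"
  by (induction i) (simp_all add: orbit_Suc divide)

lemma orbit_period [simp]: "orbit \<sigma> x n = x"
  by (simp add: orbit_def period)

lemma orbit_mod [simp]: "orbit \<sigma> x (i mod n) = orbit \<sigma> x i"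
proof -
  have "orbit \<sigma> x (r + n * k) = orbit \<sigma> x r" for r k
  proof (induction k)
    case (Suc k)
    have "(\<sigma> ^^ (r + n * k + n)) x = (\<sigma> ^^ (r + n * k)) x"
      by (simp add: funpow_add period)
    with Suc show ?case by (simp add: orbit_def algebra_simps)
  qed simp
  from this [of "i mod n" "i div n"] show ?thesis by simp
qed

lemma hom_G: "\<sigma> (G w k) = G (\<lambda>i. \<sigma> (w i)) k"
  by (induction w k rule: G.induct) (simp_all add: one uminus diff mult)

lemma formal_cleared_G:
  assumes "c \<noteq> 0"
  shows "conj_prod (formal_b_over_c \<sigma> n c) k * G (formal_u \<sigma> n a c) k =
      to_fract (cleared_G (\<lambda>i. bConst (1 / orbit \<sigma> c i) * bConst (orbit \<sigma> a i))
                          (\<lambda>i. bConst (1 / orbit \<sigma> c i) * bVar (i mod n)) k)"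
proof -
  have "conj_prod (formal_b_over_c \<sigma> n c) k * G (formal_u \<sigma> n a c) k =
      cleared_G (\<lambda>i. formal_const \<sigma> a i / formal_const \<sigma> c i)
                (\<lambda>i. formal_b n i / formal_const \<sigma> c i) k"
    unfolding formal_b_over_c_def formal_u_def
    by (rule conj_prod_G) (use assms in \<open>simp_all add: formal_b_def formal_const_def\<close>)
  also have "\<dots> = to_fract (cleared_G (\<lambda>i. bConst (1 / orbit \<sigma> c i) * bConst (orbit \<sigma> a i))
                          (\<lambda>i. bConst (1 / orbit \<sigma> c i) * bVar (i mod n)) k)"
    using assms
    by (subst cleared_G_hom [where h = to_fract])
      (simp_all add: formal_b_def formal_const_def to_fract_divide_bConst del: to_fract_mult,
       simp_all)
  finally show ?thesis .
qed

theorem cleared_value_G: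
  assumes "c \<noteq> 0"
  shows "cleared_value \<sigma> b (conj_prod (formal_b_over_c \<sigma> n c) k * G (formal_u \<sigma> n a c) k) =
    cleared_G (orbit \<sigma> (a / c)) (orbit \<sigma> (b / c)) k"
  unfolding formal_cleared_G [OF assms] cleared_value_to_fract
  by (subst cleared_G_hom [where h = "beval (orbit \<sigma> b)"])
    (simp_all add: orbit_divide [abs_def])

theorem cleared_value_G_sum:
  assumes "c \<noteq> 0"
  shows "cleared_value \<sigma> b (conj_prod (formal_b_over_c \<sigma> n c) n *
      (G (formal_u \<sigma> n a c) n + G (conj_shift (formal_u \<sigma> n a c)) n
        + G (conj_shift (formal_u \<sigma> n a c)) (n - 1))) =
    cleared_G (orbit \<sigma> (a / c)) (orbit \<sigma> (b / c)) n
      + \<sigma> (cleared_G (orbit \<sigma> (a / c)) (orbit \<sigma> (b / c)) n)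
      + b / c * \<sigma> (cleared_G (orbit \<sigma> (a / c)) (orbit \<sigma> (b / c)) (n - 1))"
proof -
  define A where "A = (\<lambda>i. bConst (1 / orbit \<sigma> c i) * bConst (orbit \<sigma> a i))"
  define B where "B = (\<lambda>i. bConst (1 / orbit \<sigma> c i) * bVar (i mod n))"
  have A: "(\<lambda>i. formal_const \<sigma> a i / formal_const \<sigma> c i) = (\<lambda>i. to_fract (A i))"
    and B: "(\<lambda>i. formal_b n i / formal_const \<sigma> c i) = (\<lambda>i. to_fract (B i))"
    using assms
    by (simp_all add: A_def B_def formal_b_def formal_const_def to_fract_divide_bConst
        del: to_fract_mult)
  have hom: "cleared_G (\<lambda>i. to_fract (f i)) (\<lambda>i. to_fract (g i)) k = to_fract (cleared_G f g k)"
    for f g :: "nat \<Rightarrow> 'a bpoly" and k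
    by (rule cleared_G_hom [symmetric]) simp_all
  have hom': "beval (orbit \<sigma> b) (cleared_G f g k) =
      cleared_G (\<lambda>i. beval (orbit \<sigma> b) (f i)) (\<lambda>i. beval (orbit \<sigma> b) (g i)) k"
    for f g :: "nat \<Rightarrow> 'a bpoly" and k
    by (rule cleared_G_hom) simp_all
  have eqs: "beval (orbit \<sigma> b) (A i) = orbit \<sigma> (a / c) i"
    "beval (orbit \<sigma> b) (B i) = orbit \<sigma> (b / c) i" for i
    by (simp_all add: A_def B_def orbit_divide)
  have \<sigma>: "\<sigma> (cleared_G f g k) = cleared_G (\<lambda>i. \<sigma> (f i)) (\<lambda>i. \<sigma> (g i)) k" for f g k
    by (rule cleared_G_hom) (simp_all add: one mult diff uminus)
  have "conj_prod (formal_b_over_c \<sigma> n c) n *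
      (G (formal_u \<sigma> n a c) n + G (conj_shift (formal_u \<sigma> n a c)) n
        + G (conj_shift (formal_u \<sigma> n a c)) (n - 1)) =
    to_fract (cleared_G A B n + cleared_G (conj_shift A) (conj_shift B) n
      + B 0 * cleared_G (conj_shift A) (conj_shift B) (n - 1))"
    using conj_prod_G_sum [of "formal_b n" "formal_const \<sigma> c" n "formal_const \<sigma> a"] assms n_ge_2
    unfolding formal_b_over_c_def [abs_def] formal_u_def A B fun_cong [OF B, of 0]
    by (simp add: conj_shift_def hom) (simp add: formal_b_def formal_const_def)
  then show ?thesis
    by (simp only: cleared_value_to_fract beval_add beval_mult hom' eqs \<sigma> conj_shift_def
        orbit_Suc orbit_0)
qed

text \<open>For nonzero \<open>b\<close> the cleared values are the literal ones.\<close>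

lemma orbit_u:
  "orbit \<sigma> (\<sigma> a * c / (\<sigma> b * b)) = u_expr (orbit \<sigma> a) (orbit \<sigma> b) (orbit \<sigma> c)"
proof
  fix i
  have m: "orbit \<sigma> (x * y) i = orbit \<sigma> x i * orbit \<sigma> y i" for x y
    by (induction i) (simp_all add: orbit_Suc mult)
  have s: "orbit \<sigma> (\<sigma> x) i = orbit \<sigma> x (Suc i)" for x
    by (simp add: orbit_def funpow_swap1)
  show "orbit \<sigma> (\<sigma> a * c / (\<sigma> b * b)) i = u_expr (orbit \<sigma> a) (orbit \<sigma> b) (orbit \<sigma> c) i"
    by (simp add: u_expr_def orbit_divide m s)
qed

theorem cleared_value_G_literal:
  fixes a b c :: 'a
  assumes "b \<noteq> 0" "c \<noteq> 0"
  defines "u \<equiv> \<sigma> a * c / (\<sigma> b * b)"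
  shows "cleared_value \<sigma> b (conj_prod (formal_b_over_c \<sigma> n c) k * G (formal_u \<sigma> n a c) k) =
    conj_prod (orbit \<sigma> (b / c)) k * G (orbit \<sigma> u) k"
proof -
  have d: "orbit \<sigma> (x / y) = (\<lambda>i. orbit \<sigma> x i / orbit \<sigma> y i)" for x y
    by (rule ext) (rule orbit_divide)
  show ?thesis
    unfolding cleared_value_G [OF \<open>c \<noteq> 0\<close>] u_def orbit_u d [of a c] d [of b c]
    by (rule conj_prod_G [symmetric]) (use assms in simp_all)
qed

theorem cleared_value_G_sum_literal:
  fixes a b c :: 'a
  assumes "b \<noteq> 0" "c \<noteq> 0"
  defines "u \<equiv> \<sigma> a * c / (\<sigma> b * b)"
  shows "cleared_value \<sigma> b (conj_prod (formal_b_over_c \<sigma> n c) n *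
      (G (formal_u \<sigma> n a c) n + G (conj_shift (formal_u \<sigma> n a c)) n
        + G (conj_shift (formal_u \<sigma> n a c)) (n - 1))) =
    conj_prod (orbit \<sigma> (b / c)) n *
      (G (orbit \<sigma> u) n + \<sigma> (G (orbit \<sigma> u) n) + \<sigma> (G (orbit \<sigma> u) (n - 1)))"
proof -
  have d: "orbit \<sigma> (x / y) = (\<lambda>i. orbit \<sigma> x i / orbit \<sigma> y i)" for x y
    by (rule ext) (rule orbit_divide)
  have \<sigma>: "\<sigma> (cleared_G f g k) = cleared_G (\<lambda>i. \<sigma> (f i)) (\<lambda>i. \<sigma> (g i)) k" for f g k
    by (rule cleared_G_hom) (simp_all add: one mult diff uminus)
  have s: "conj_shift (orbit \<sigma> x) = (\<lambda>i. \<sigma> (orbit \<sigma> x i))" for x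
    by (simp add: conj_shift_def orbit_Suc)
  have "conj_prod (orbit \<sigma> (b / c)) n * (G (orbit \<sigma> u) n + G (conj_shift (orbit \<sigma> u)) n
        + G (conj_shift (orbit \<sigma> u)) (n - 1)) =
    cleared_G (orbit \<sigma> (a / c)) (orbit \<sigma> (b / c)) n
    + cleared_G (conj_shift (orbit \<sigma> (a / c))) (conj_shift (orbit \<sigma> (b / c))) n
    + orbit \<sigma> (b / c) 0 *
        cleared_G (conj_shift (orbit \<sigma> (a / c))) (conj_shift (orbit \<sigma> (b / c))) (n - 1)"
    unfolding u_def orbit_u d [of a c] d [of b c]
    by (rule conj_prod_G_sum) (use assms n_ge_2 in simp_all)
  then show ?thesis
    unfolding cleared_value_G_sum [OF \<open>c \<noteq> 0\<close>] s \<sigma> hom_G by simp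
qed

end

end

theory Submission
  imports Defs
begin

text \<open>
  Write \<open>\<alpha> = a / c\<close>, \<open>\<beta> = b / c\<close>. If \<open>x\<close> is a root, its orbit satisfies the linear recursion
  \<open>X (i + 2) = - \<sigma>\<^sup>i \<beta> X (i + 1) - \<sigma>\<^sup>i \<alpha> X i\<close>, so \<open>(x, \<sigma> x)\<close> is fixed by the monodromy matrix \<open>M\<close>
  that advances this recursion by \<open>n\<close> steps. The entries of \<open>M\<close> are cleared values of the \<open>G\<^sub>k\<close>, its
  determinant is \<open>N(a/c)\<close>, and the quantity in (ii) and (iii) is \<open>det (M - 1)\<close>, while the
  condition in (i) says \<open>M = 1\<close>. Conversely, the operator \<open>v \<mapsto> \<sigma>\<^sup>-\<^sup>1 (C v)\<close>, with \<open>C\<close> the companion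
  matrix, is semilinear with \<open>n\<close>-th power \<open>M\<close>, so Galois descent, via Dedekind's independence of
  characters, shows that the roots form a space over the field of \<open>q\<close> elements whose dimension
  is that of \<open>ker (M - 1)\<close>.
\<close>

section \<open>Independence of characters and polynomials over finite fields\<close>

text \<open>Evaluate the relation at \<open>y * x\<close> and subtract \<open>\<chi> j y\<close>
  times the relation at \<open>x\<close>: the term of \<open>j\<close> cancels. The shorter relation
  has coefficients \<open>c k * (\<chi> k y - \<chi> j y)\<close>, and some \<open>y\<close>
  separates \<open>\<chi> k\<close> from \<open>\<chi> j\<close>.\<close>

lemma Dedekind_independence:
  fixes \<chi> :: "'i \<Rightarrow> 'a::monoid_mult \<Rightarrow> 'b::field"
  assumes "finite I" "inj_on \<chi> I"
    and "\<And>i. i \<in> I \<Longrightarrow> \<chi> i 1 = 1"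
    and "\<And>i x y. i \<in> I \<Longrightarrow> \<chi> i (x * y) = \<chi> i x * \<chi> i y"
    and "\<And>x. (\<Sum>i\<in>I. c i * \<chi> i x) = 0"
    and "i \<in> I"
  shows "c i = 0"
  using assms
proof (induction I arbitrary: c i rule: finite_induct)
  case (insert j I)
  have zero: "c k = 0" if "k \<in> I" for k
  proof -
    have "c k * (\<chi> k y - \<chi> j y) = 0" for y
    proof (rule insert.IH [where c = "\<lambda>k. c k * (\<chi> k y - \<chi> j y)"])
      fix x
      have "(\<Sum>i\<in>I. c i * (\<chi> i y - \<chi> j y) * \<chi> i x) =
          (\<Sum>i\<in>I. c i * \<chi> i (y * x)) - \<chi> j y * (\<Sum>i\<in>I. c i * \<chi> i x)"
        unfolding sum_distrib_left sum_subtractf [symmetric]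
        by (rule sum.cong) (simp_all add: insert.prems algebra_simps)
      also have "\<dots> = (\<Sum>i\<in>insert j I. c i * \<chi> i (y * x))
          - \<chi> j y * (\<Sum>i\<in>insert j I. c i * \<chi> i x)"
        using insert.hyps insert.prems(3)[of j y x] by (simp add: algebra_simps)
      also have "\<dots> = 0"
        by (simp only: insert.prems(4)) simp
      finally show "(\<Sum>i\<in>I. c i * (\<chi> i y - \<chi> j y) * \<chi> i x) = 0" .
    qed (use insert.prems that in auto)
    moreover have "\<exists>y. \<chi> k y \<noteq> \<chi> j y"
      using insert.prems(1) insert.hyps(2) that by (auto simp: inj_on_def fun_eq_iff)
    ultimately show ?thesis by auto
  qed
  have "c j = 0"
    using insert.prems(4) [of 1] insert.hyps insert.prems(2)[of j] zero by simp
  with zero insert.prems(5) show ?case by auto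
qed simp

section \<open>Coefficientwise homomorphisms, characteristic and root bounds\<close>

lemma map_poly_mult_hom:
  fixes h :: "'a::comm_ring_1 \<Rightarrow> 'a"
  assumes "h 0 = 0" "\<And>x y. h (x + y) = h x + h y" "\<And>x y. h (x * y) = h x * h y"
  shows "map_poly h (p * r) = map_poly h p * map_poly h r"
proof (rule poly_eqI)
  fix k
  have "h (sum f S) = (\<Sum>i\<in>S. h (f i))" if "finite S" for f and S :: "nat set"
    using that by induction (simp_all add: assms)
  then show "coeff (map_poly h (p * r)) k = coeff (map_poly h p * map_poly h r) k"
    by (simp add: coeff_map_poly coeff_mult assms)
qed

lemma map_poly_prod_hom:
  fixes h :: "'a::comm_ring_1 \<Rightarrow> 'a"
  assumes "h 0 = 0" "h 1 = 1" "\<And>x y. h (x + y) = h x + h y" "\<And>x y. h (x * y) = h x * h y"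
  shows "map_poly h (prod f S) = (\<Prod>i\<in>S. map_poly h (f i))"
  by (induction S rule: infinite_finite_induct) (simp_all add: assms map_poly_mult_hom)

lemma poly_map_poly_hom:
  fixes h :: "'a::comm_ring_1 \<Rightarrow> 'a"
  assumes "h 0 = 0" "\<And>x y. h (x + y) = h x + h y" "\<And>x y. h (x * y) = h x * h y"
  shows "poly (map_poly h p) (h x) = h (poly p x)"
  by (induction p) (simp_all add: map_poly_pCons assms)

lemma CHAR_eq_of_card:
  assumes "prime p" "card (UNIV :: 'a::finite_field set) = p ^ k"
  shows "CHAR('a) = p"
proof -
  \<comment> \<open>Translation by 1 permutes the field, so the cardinality is zero in it.\<close>
  have "(\<Sum>x\<in>UNIV. x + 1) = (\<Sum>x\<in>UNIV. x :: 'a)"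
    by (rule sum.reindex_bij_witness [of _ "\<lambda>x. x - 1" "\<lambda>x. x + 1"]) auto
  then have "of_nat (card (UNIV :: 'a set)) = (0 :: 'a)"
    by (simp add: sum.distrib)
  then have "CHAR('a) dvd p ^ k"
    by (simp only: of_nat_eq_0_iff_char_dvd assms(2))
  moreover have "prime CHAR('a)" by (rule CHAR_prime)
  ultimately show ?thesis
    using assms(1) prime_dvd_power primes_dvd_imp_eq by blast
qed

lemma card_fixed_power_le:
  assumes "m > 1"
  shows "card {x :: 'a::field. x ^ m = x} \<le> m"
proof -
  let ?p = "monom 1 m - monom 1 1 :: 'a poly"
  have "coeff ?p m = 1" using assms by simp
  then have "?p \<noteq> 0" by (metis coeff_0 zero_neq_one)
  then have "card {x. poly ?p x = 0} \<le> degree ?p" by (rule card_poly_roots_bound)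
  also have "\<dots> \<le> m"
    by (rule degree_diff_le) (use assms in \<open>simp_all add: degree_monom_eq\<close>)
  finally show ?thesis by (simp add: poly_monom)
qed


section \<open>A generator of the Galois group\<close>

locale cyclic_finite_ext =
  fixes \<sigma> :: "'a::finite_field \<Rightarrow> 'a" and q n :: nat
  assumes q: "primepow q" and n: "n \<ge> 2" and card_UNIV: "card (UNIV :: 'a set) = q ^ n"
    and gen: "generates_Gal q \<sigma>"
begin

lemma q_gt_1: "q > 1"
  using primepow_gt_Suc_0 [OF q] by simp

lemma
  shows \<sigma>_1: "\<sigma> 1 = 1"
    and \<sigma>_add: "\<sigma> (x + y) = \<sigma> x + \<sigma> y"
    and \<sigma>_mult: "\<sigma> (x * y) = \<sigma> x * \<sigma> y"
    and \<sigma>_fixed: "x ^ q = x \<Longrightarrow> \<sigma> x = x"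
  using gen unfolding generates_Gal_def Gal_def by auto

lemma \<sigma>_0: "\<sigma> 0 = 0"
  by (rule \<sigma>_fixed) (use q_gt_1 in simp)

lemma \<sigma>_power: "\<sigma> (x ^ k) = \<sigma> x ^ k"
  by (induction k) (simp_all add: \<sigma>_1 \<sigma>_mult)

text \<open>\<open>q\<close> is a power of the characteristic, so raising to a power of
  \<open>q\<close> is additive.\<close>

lemma q_power_sum: "(\<Sum>i\<in>S. f i) ^ q ^ k = (\<Sum>i\<in>S. f i ^ q ^ k)" for f :: "'i \<Rightarrow> 'a"
proof -
  obtain p s where "prime p" "q = p ^ s"
    using q by (auto simp: primepow_def)
  moreover from this have "CHAR('a) = p"
    by (intro CHAR_eq_of_card [of p "s * n"]) (simp_all add: card_UNIV power_mult)
  ultimately show ?thesis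
    by (intro freshmans_dream_sum' [of _ "s * k"]) (simp_all add: power_mult)
qed

lemma q_power_add: "(x + y) ^ q = x ^ q + y ^ q" for x y :: 'a
  using q_power_sum [of "\<lambda>b. if b then x else y" UNIV 1] by (simp add: UNIV_bool add.commute)

lemma power_card: "x ^ q ^ n = x" for x :: 'a
  using finite_field_power_card_eq_same [of x] by (simp add: card_UNIV)

text \<open>Raising to the power \<open>q ^ (n - 1)\<close> undoes the Frobenius map, since
  \<open>x ^ q ^ n = x\<close>. Membership makes the Frobenius map a power of
  \<open>\<sigma>\<close>.\<close>

lemma Frobenius_in_Gal: "(\<lambda>x. x ^ q) \<in> (Gal q :: ('a \<Rightarrow> 'a) set)"
proof -
  have "inj (\<lambda>x :: 'a. x ^ q)"
  proof (rule injI)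
    fix x y :: 'a
    assume "x ^ q = y ^ q"
    then have "(x ^ q) ^ q ^ (n - 1) = (y ^ q) ^ q ^ (n - 1)" by simp
    moreover have "(z ^ q) ^ q ^ (n - 1) = z ^ q ^ n" for z :: 'a
      using n by (cases n) (simp_all flip: power_mult)
    ultimately show "x = y" by (simp add: power_card)
  qed
  then have "bij (\<lambda>x :: 'a. x ^ q)"
    by (simp add: bij_def finite_UNIV_inj_surj)
  then show ?thesis
    by (simp add: Gal_def q_power_add power_mult_distrib)
qed

lemma Frobenius_eq_funpow: "\<exists>j. \<forall>x. x ^ q = (\<sigma> ^^ j) x"
  using Frobenius_in_Gal gen unfolding generates_Gal_def by (auto simp: fun_eq_iff)

text \<open>\<open>\<sigma> x\<close> is a root of the polynomial with roots the Frobenius conjugates of \<open>x\<close>.\<close>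

lemma \<sigma>_eq_q_power: "\<exists>i. \<sigma> x = x ^ q ^ i"
proof -
  define P where "P = (\<Prod>i<n. [:- (x ^ q ^ i), 1:])"
  \<comment> \<open>Deduced from additivity, which avoids distinguishing the parity of
    \<open>q\<close>.\<close>
  have minus: "(- y) ^ q = - (y ^ q)" for y :: 'a
    using q_power_add [of y "- y"] q_gt_1
    by (simp add: eq_neg_iff_add_eq_0 add.commute power_0_left)
  \<comment> \<open>Frobenius permutes the factors cyclically because \<open>x ^ q ^ n = x\<close>.
    Hence the coefficients of \<open>P\<close> are fixed by Frobenius, and so by
    \<open>\<sigma>\<close>.\<close>
  have "map_poly (\<lambda>x. x ^ q) P = (\<Prod>i<n. [:- (x ^ q ^ Suc i), 1:])"
    unfolding P_def using q_gt_1
    by (subst map_poly_prod_hom)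
      (simp_all add: q_power_add power_mult_distrib map_poly_pCons minus mult.commute
        flip: power_mult)
  also have "\<dots> = P"
  proof -
    have "(\<Prod>i<n. [:- (x ^ q ^ Suc i), 1:]) * [:- (x ^ q ^ 0), 1:] = (\<Prod>i<Suc n. [:- (x ^ q ^ i), 1:])"
      by (subst prod.lessThan_Suc_shift) (simp add: mult.commute)
    also have "\<dots> = P * [:- (x ^ q ^ 0), 1:]"
      by (simp add: P_def power_card)
    finally show ?thesis
      by (subst (asm) mult_cancel_right) auto
  qed
  finally have "coeff P k ^ q = coeff P k" for k
    using q_gt_1 by (metis coeff_map_poly power_0_left less_nat_zero_code)
  then have "\<sigma> (coeff P k) = coeff P k" for k
    by (rule \<sigma>_fixed)
  then have "map_poly \<sigma> P = P"
    by (intro poly_eqI) (simp add: coeff_map_poly \<sigma>_0)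
  then have "poly P (\<sigma> x) = \<sigma> (poly P x)"
    using poly_map_poly_hom [of \<sigma> P x] by (simp add: \<sigma>_0 \<sigma>_add \<sigma>_mult)
  also have "poly P x = 0"
    using n by (auto simp: P_def poly_prod intro!: prod_zero bexI [of _ 0])
  finally show ?thesis
    by (auto simp: P_def poly_prod \<sigma>_0)
qed

text \<open>The exponent \<open>i\<close> may depend on \<open>x\<close>, but
  \<open>\<sigma>\<close> commutes with powers, so the same \<open>i\<close> serves along the whole
  orbit of \<open>x\<close>.\<close>

lemma funpow_\<sigma>_n: "(\<sigma> ^^ n) x = x"
proof -
  obtain i where i: "\<sigma> x = x ^ q ^ i" using \<sigma>_eq_q_power by blast
  have "(\<sigma> ^^ k) x = x ^ q ^ (i * k)" for k
    by (induction k) (simp_all add: \<sigma>_power i power_add flip: power_mult)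
  moreover have "x ^ q ^ (n * k) = x" for k
    by (rule finite_field_power_card_power_eq_same) (simp add: card_UNIV power_mult)
  ultimately show ?thesis by (metis mult.commute)
qed

text \<open>As Frobenius is a power of \<open>\<sigma>\<close>, all \<open>q ^ n\<close> elements
  would satisfy \<open>x ^ q ^ m = x\<close>, an equation with at most \<open>q ^ m\<close>
  solutions.\<close>

lemma order_\<sigma>_ge:
  assumes "m > 0" "\<And>x. (\<sigma> ^^ m) x = x"
  shows "n \<le> m"
proof -
  obtain j where j: "\<And>x. x ^ q = (\<sigma> ^^ j) x" using Frobenius_eq_funpow by blast
  have "x ^ q ^ k = (\<sigma> ^^ (j * k)) x" for x k
  proof (induction k)
    case (Suc k)
    have "x ^ q ^ Suc k = (x ^ q ^ k) ^ q" by (simp add: mult.commute flip: power_mult)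
    also have "\<dots> = (\<sigma> ^^ (j * Suc k)) x" by (simp add: Suc j funpow_add)
    finally show ?case .
  qed simp
  moreover have "(\<sigma> ^^ (m * k)) x = x" for x k
    by (induction k) (simp_all add: funpow_add assms)
  ultimately have "{x :: 'a. x ^ q ^ m = x} = UNIV" by (auto simp: mult.commute)
  moreover have "q ^ m > 1" using q_gt_1 assms(1) by (rule one_less_power)
  ultimately have "q ^ n \<le> q ^ m"
    using card_fixed_power_le [of "q ^ m", where 'a = 'a] by (simp add: card_UNIV)
  then show ?thesis using q_gt_1 by simp
qed

lemma \<sigma>_eq_iff: "\<sigma> x = x \<longleftrightarrow> x ^ q = x"
proof
  assume "\<sigma> x = x"
  then have "(\<sigma> ^^ k) x = x" for k by (induction k) simp_all
  then show "x ^ q = x" using Frobenius_eq_funpow by metis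
qed (rule \<sigma>_fixed)

section \<open>The size of the fixed field\<close>

lemma card_trace_kernel_le: "card {y :: 'a. (\<Sum>i<n. y ^ q ^ i) = 0} \<le> q ^ (n - 1)"
proof -
  let ?p = "\<Sum>i<n. monom 1 (q ^ i) :: 'a poly"
  \<comment> \<open>Only \<open>i = 0\<close> gives \<open>q ^ i = 1\<close>, so the linear
    coefficient shows that the trace polynomial is nonzero.\<close>
  have "coeff ?p 1 = (\<Sum>i<n. if i = 0 then 1 else 0)"
    unfolding coeff_sum by (rule sum.cong) (use q_gt_1 in auto)
  also have "\<dots> = 1" using n by simp
  finally have "?p \<noteq> 0" by force
  then have "card {x. poly ?p x = 0} \<le> degree ?p" by (rule card_poly_roots_bound)
  also have "\<dots> \<le> q ^ (n - 1)"
    by (rule degree_sum_le) (use q_gt_1 in \<open>auto simp: degree_monom_eq\<close>)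
  finally show ?thesis by (simp add: poly_sum poly_monom)
qed

text \<open>For the lower bound, the image of \<open>x \<mapsto> x\<^sup>q - x\<close> lies in the kernel of the trace.\<close>

lemma card_fixed: "card {x. \<sigma> x = x} = q"
proof (rule antisym)
  show "card {x. \<sigma> x = x} \<le> q"
    unfolding \<sigma>_eq_iff by (rule card_fixed_power_le) (rule q_gt_1)
next
  define F where "F = {x :: 'a. x ^ q = x}"
  define f where "f x = x ^ q - x" for x :: 'a
  define Z where "Z = {y :: 'a. (\<Sum>i<n. y ^ q ^ i) = 0}"
  have diff: "(x - y) ^ q = x ^ q - y ^ q" for x y :: 'a
    using q_power_add [of "x - y" y] by simp
  have "f x \<in> Z" for x
  proof -
    have pow: "(x - y) ^ q ^ i = x ^ q ^ i - y ^ q ^ i" for x y :: 'a and i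
      by (induction i arbitrary: x y) (simp_all add: power_mult diff)
    have "(\<Sum>i<n. f x ^ q ^ i) = (\<Sum>i<n. x ^ q ^ Suc i - x ^ q ^ i)"
      by (rule sum.cong) (simp_all add: f_def pow flip: power_mult)
    also have "\<dots> = 0" by (subst sum_lessThan_telescope) (simp add: power_card)
    finally show ?thesis by (simp add: Z_def)
  qed
  \<comment> \<open>Subtracting one point of a nonempty fibre moves the fibre into \<open>F\<close>.
    Counting the field by fibres then gives \<open>q ^ n \<le> card Z * card F\<close>.\<close>
  moreover have "card (f -` {y}) \<le> card F" for y
  proof (cases "f -` {y} = {}")
    case False
    then obtain x where x: "f x = y" by auto
    have "(\<lambda>z. z - x) ` (f -` {y}) \<subseteq> F"
      using x by (auto simp: f_def F_def diff algebra_simps)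
    then have "card ((\<lambda>z. z - x) ` (f -` {y})) \<le> card F" by (intro card_mono) auto
    then show ?thesis by (simp add: card_image inj_on_def)
  qed simp
  ultimately have "card (\<Union>y\<in>Z. f -` {y}) \<le> card Z * card F" "(\<Union>y\<in>Z. f -` {y}) = UNIV"
    by (auto intro!: order_trans [OF card_UN_le] order_trans [OF sum_bounded_above])
  then have "q ^ n \<le> card Z * card F" by (simp add: card_UNIV)
  also have "\<dots> \<le> q ^ (n - 1) * card F"
    using card_trace_kernel_le by (intro mult_right_mono) (simp_all add: Z_def)
  finally show "q \<le> card {x. \<sigma> x = x}"
    using n q_gt_1 by (cases n) (simp_all add: F_def \<sigma>_eq_iff mult.commute)
qed

end


section \<open>The monodromy of the recursion\<close>

text \<open>The solutions with initial values \<open>(1, 0)\<close> and \<open>(0, 1)\<close>, read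
  at indices \<open>n\<close> and \<open>Suc n\<close>, form the columns of the monodromy matrix
  \<open>M\<close>.\<close>

fun lin_rec :: "(nat \<Rightarrow> 'r::comm_ring_1) \<Rightarrow> (nat \<Rightarrow> 'r) \<Rightarrow> 'r \<Rightarrow> 'r \<Rightarrow> nat \<Rightarrow> 'r" where
  "lin_rec \<alpha> \<beta> v w 0 = v"
| "lin_rec \<alpha> \<beta> v w (Suc 0) = w"
| "lin_rec \<alpha> \<beta> v w (Suc (Suc k)) = - \<beta> k * lin_rec \<alpha> \<beta> v w (Suc k) - \<alpha> k * lin_rec \<alpha> \<beta> v w k"

lemma lin_rec_linear: "lin_rec \<alpha> \<beta> v w k = v * lin_rec \<alpha> \<beta> 1 0 k + w * lin_rec \<alpha> \<beta> 0 1 k"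
  by (induction k rule: induct_nat_012) (simp_all add: algebra_simps)

lemma lin_rec_0_1: "lin_rec \<alpha> \<beta> 0 1 (Suc k) = cleared_G \<alpha> \<beta> k"
  by (induction k rule: induct_nat_012) simp_all

text \<open>From index 1 on, this solution starts with \<open>0\<close> and
  \<open>- \<alpha> 0\<close>, so it is a multiple of the other basic solution for the shifted
  coefficients.\<close>

lemma lin_rec_1_0:
  "lin_rec \<alpha> \<beta> 1 0 (Suc (Suc k)) = - \<alpha> 0 * cleared_G (conj_shift \<alpha>) (conj_shift \<beta>) k"
proof (induction k rule: induct_nat_012)
  case (ge2 k)
  have "lin_rec \<alpha> \<beta> 1 0 (Suc (Suc (Suc (Suc k)))) =
      - \<beta> (Suc (Suc k)) * lin_rec \<alpha> \<beta> 1 0 (Suc (Suc (Suc k)))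
      - \<alpha> (Suc (Suc k)) * lin_rec \<alpha> \<beta> 1 0 (Suc (Suc k))"
    by (rule lin_rec.simps(3))
  then show ?case
    unfolding ge2.IH by (simp add: conj_shift_def algebra_simps del: lin_rec.simps)
qed (simp_all add: conj_shift_def)

text \<open>Each step multiplies the determinant by that of the companion matrix,
  \<open>\<alpha> k\<close>. At \<open>k = n\<close> this gives \<open>det M\<close> as a
  norm.\<close>

lemma lin_rec_Casoratian:
  "lin_rec \<alpha> \<beta> 1 0 k * lin_rec \<alpha> \<beta> 0 1 (Suc k) - lin_rec \<alpha> \<beta> 1 0 (Suc k) * lin_rec \<alpha> \<beta> 0 1 k
    = conj_prod \<alpha> k"
proof (induction k)
  case (Suc k)
  have "lin_rec \<alpha> \<beta> 1 0 (Suc k) * lin_rec \<alpha> \<beta> 0 1 (Suc (Suc k))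
      - lin_rec \<alpha> \<beta> 1 0 (Suc (Suc k)) * lin_rec \<alpha> \<beta> 0 1 (Suc k) =
    \<alpha> k * (lin_rec \<alpha> \<beta> 1 0 k * lin_rec \<alpha> \<beta> 0 1 (Suc k)
      - lin_rec \<alpha> \<beta> 1 0 (Suc k) * lin_rec \<alpha> \<beta> 0 1 k)"
    by (simp add: algebra_simps)
  then show ?case
    by (simp only: Suc.IH) (simp add: conj_prod_def mult.commute)
qed (simp add: conj_prod_def)

section \<open>Kernels of 2 by 2 matrices\<close>

lemma kernel_2x2_trivial:
  fixes p :: "'f::field"
  assumes "p * s - q * r \<noteq> 0" "p * v + q * w = 0" "r * v + s * w = 0"
  shows "v = 0"
proof -
  have "(p * s - q * r) * v = s * (p * v + q * w) - q * (r * v + s * w)"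
    by (simp add: algebra_simps)
  also have "\<dots> = 0" by (simp only: assms) simp
  finally show ?thesis using assms(1) by (metis mult_eq_0_iff)
qed

lemma singular_2x2_kernel:
  fixes p :: "'f::field"
  assumes "p * s = q * r"
  obtains v w where "v \<noteq> 0 \<or> w \<noteq> 0" "p * v + q * w = 0" "r * v + s * w = 0"
proof (cases "p = 0 \<and> q = 0")
  case True
  show thesis
  proof (cases "r = 0 \<and> s = 0")
    case True
    with \<open>p = 0 \<and> q = 0\<close> show thesis by (intro that [of 1 0]) auto
  next
    case False
    with \<open>p = 0 \<and> q = 0\<close> show thesis by (intro that [of s "- r"]) auto
  qed
next
  case False
  with assms show thesis by (intro that [of q "- p"]) (auto simp: algebra_simps)
qed

text \<open>Every matrix entry annihilates the determinant of the two kernel vectors, and some entry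
  is nonzero.\<close>

lemma kernel_2x2_parallel:
  fixes p :: "'f::field"
  assumes "p \<noteq> 0 \<or> q \<noteq> 0 \<or> r \<noteq> 0 \<or> s \<noteq> 0"
    and "p * v + q * w = 0" "r * v + s * w = 0" "p * v' + q * w' = 0" "r * v' + s * w' = 0"
  shows "v * w' = v' * w"
proof -
  have "p * (v * w' - v' * w) = w' * (p * v + q * w) - w * (p * v' + q * w')"
    "q * (v * w' - v' * w) = v * (p * v' + q * w') - v' * (p * v + q * w)"
    "r * (v * w' - v' * w) = w' * (r * v + s * w) - w * (r * v' + s * w')"
    "s * (v * w' - v' * w) = v * (r * v' + s * w') - v' * (r * v + s * w)"
    by (simp_all add: algebra_simps)
  with assms show ?thesis by auto
qed

section \<open>The inverse of \<open>\<sigma>\<close> and twisted sums\<close>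

context cyclic_finite_ext
begin

sublocale field_aut_order \<sigma> n
  by unfold_locales (simp_all add: \<sigma>_1 \<sigma>_add \<sigma>_mult funpow_\<sigma>_n n)

text \<open>The inverse of \<open>\<sigma>\<close>, written as a power so that the homomorphism laws
  carry over.\<close>

definition \<tau> :: "'a \<Rightarrow> 'a" where "\<tau> = \<sigma> ^^ (n - 1)"

lemma \<sigma>_\<tau>: "\<sigma> (\<tau> x) = x"
proof -
  have "\<sigma> (\<tau> x) = (\<sigma> ^^ Suc (n - 1)) x" by (simp add: \<tau>_def)
  then show ?thesis using n by (simp add: funpow_\<sigma>_n del: funpow.simps)
qed

lemma \<tau>_\<sigma>: "\<tau> (\<sigma> x) = x"
  using \<sigma>_\<tau> [of x] by (simp add: \<tau>_def funpow_swap1)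

lemma funpow_hom:
  "(\<sigma> ^^ k) 1 = 1" "(\<sigma> ^^ k) (x + y) = (\<sigma> ^^ k) x + (\<sigma> ^^ k) y"
  "(\<sigma> ^^ k) (x * y) = (\<sigma> ^^ k) x * (\<sigma> ^^ k) y"
  by (induction k) (simp_all add: one add mult)

lemma funpow_\<tau>_hom:
  "(\<tau> ^^ k) 1 = 1" "(\<tau> ^^ k) (x + y) = (\<tau> ^^ k) x + (\<tau> ^^ k) y"
  "(\<tau> ^^ k) (x * y) = (\<tau> ^^ k) x * (\<tau> ^^ k) y"
  unfolding \<tau>_def funpow_mult by (rule funpow_hom)+

lemma funpow_\<tau>_0: "(\<tau> ^^ k) 0 = 0"
proof -
  have "(\<tau> ^^ k) 0 + (\<tau> ^^ k) 0 = (\<tau> ^^ k) (0 + 0)" by (rule funpow_\<tau>_hom(2) [symmetric])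
  also have "\<dots> = (\<tau> ^^ k) 0 + 0" by simp
  finally show ?thesis by (rule add_left_imp_eq)
qed

lemma funpow_\<tau>_\<sigma>: "(\<tau> ^^ k) ((\<sigma> ^^ k) x) = x"
  by (induction k arbitrary: x) (simp_all add: funpow_swap1 [of \<tau>] \<tau>_\<sigma>)

lemma funpow_\<sigma>_\<tau>: "(\<sigma> ^^ k) ((\<tau> ^^ k) x) = x"
  by (induction k arbitrary: x) (simp_all add: funpow_swap1 [of \<sigma>] \<sigma>_\<tau>)

text \<open>A coincidence would make \<open>\<sigma> ^^ (j - i)\<close> the identity, against the
  order of \<open>\<sigma>\<close>. This supplies the distinct characters for Dedekind
  independence.\<close>

lemma inj_on_funpow_\<tau>: "inj_on (\<lambda>i. \<tau> ^^ i) {..<n}"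
proof (rule linorder_inj_onI)
  fix i j
  assume "i < j" "i \<in> {..<n}" "j \<in> {..<n}"
  show "\<tau> ^^ i \<noteq> \<tau> ^^ j"
  proof
    assume eq: "\<tau> ^^ i = \<tau> ^^ j"
    have "(\<sigma> ^^ (j - i)) x = x" for x
    proof -
      have "(\<sigma> ^^ (j - i)) x = (\<sigma> ^^ (j - i)) ((\<sigma> ^^ i) ((\<tau> ^^ i) x))"
        by (simp add: funpow_\<sigma>_\<tau>)
      also have "\<dots> = (\<sigma> ^^ j) ((\<tau> ^^ j) x)"
        using \<open>i < j\<close> eq by (simp flip: funpow_add [THEN fun_cong, unfolded o_apply])
      finally show ?thesis by (simp add: funpow_\<sigma>_\<tau>)
    qed
    then have "n \<le> j - i" using \<open>i < j\<close> by (intro order_\<sigma>_ge) auto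
    with \<open>i < j\<close> \<open>j \<in> {..<n}\<close> show False by simp
  qed
qed auto

lemma \<sigma>_sum: "\<sigma> (sum f S) = (\<Sum>i\<in>S. \<sigma> (f i))"
  by (induction S rule: infinite_finite_induct) (simp_all add: zero add)

text \<open>Applying \<open>\<sigma>\<close> lowers each power of \<open>\<tau>\<close> by one, a
  cyclic shift of the sum. The ends match because \<open>\<tau> ^^ n\<close> is the identity and
  \<open>Y n = Y 0\<close>.\<close>

lemma \<sigma>_twisted_sum:
  assumes "Y n = Y 0"
  shows "\<sigma> (\<Sum>i<n. (\<tau> ^^ i) (Y i)) = (\<Sum>i<n. (\<tau> ^^ i) (Y (Suc i)))"
proof -
  define h where "h i = \<sigma> ((\<tau> ^^ i) (Y i))" for i
  have "(\<tau> ^^ n) x = x" for x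
    using funpow_\<tau>_\<sigma> [of n x] by (simp add: funpow_\<sigma>_n)
  then have "h n = h 0" by (simp add: h_def assms)
  moreover have "(\<Sum>i<n. h i) + h n = h 0 + (\<Sum>i<n. h (Suc i))"
    by (subst sum.lessThan_Suc [symmetric], subst sum.lessThan_Suc_shift) simp
  ultimately have "(\<Sum>i<n. h i) = (\<Sum>i<n. h (Suc i))" by simp
  then show ?thesis by (simp add: \<sigma>_sum h_def \<sigma>_\<tau>)
qed

section \<open>Roots and invariant vectors of the monodromy\<close>

context
  fixes \<alpha> \<beta> :: 'a
begin

abbreviation "X \<equiv> lin_rec (orbit \<sigma> \<alpha>) (orbit \<sigma> \<beta>)"
abbreviation "g \<equiv> cleared_G (orbit \<sigma> \<alpha>) (orbit \<sigma> \<beta>)"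
abbreviation "roots \<equiv> {x. \<alpha> * x + \<beta> * \<sigma> x + \<sigma> (\<sigma> x) = 0}"

lemma \<sigma>_\<sigma>_root: "x \<in> roots \<Longrightarrow> \<sigma> (\<sigma> x) = - \<beta> * \<sigma> x - \<alpha> * x"
  by (simp add: eq_neg_iff_add_eq_0 algebra_simps)

text \<open>Applying \<open>\<sigma> ^^ k\<close> to the root equation yields the recursion for the
  orbit of \<open>x\<close>.\<close>

lemma lin_rec_root:
  assumes "x \<in> roots"
  shows "X x (\<sigma> x) k = orbit \<sigma> x k"
proof (induction k rule: induct_nat_012)
  case (ge2 k)
  have "orbit \<sigma> x (Suc (Suc k)) = (\<sigma> ^^ k) (\<sigma> (\<sigma> x))"
    by (simp add: orbit_def funpow_swap1)
  also have "\<dots> + orbit \<sigma> \<beta> k * orbit \<sigma> x (Suc k) + orbit \<sigma> \<alpha> k * orbit \<sigma> x k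
      = (\<sigma> ^^ k) (\<sigma> (\<sigma> x) + \<beta> * \<sigma> x + \<alpha> * x)"
    by (simp add: funpow_hom orbit_def funpow_swap1)
  also have "\<sigma> (\<sigma> x) + \<beta> * \<sigma> x + \<alpha> * x = 0"
    using assms by (simp add: algebra_simps)
  also have "(\<sigma> ^^ k) 0 = 0"
    using orbit_eq_0_iff [of 0 k] by (simp add: orbit_def)
  finally have "orbit \<sigma> x (Suc (Suc k)) =
      - (orbit \<sigma> \<beta> k * orbit \<sigma> x (Suc k) + orbit \<sigma> \<alpha> k * orbit \<sigma> x k)"
    by (simp only: eq_neg_iff_add_eq_0 add.assoc)
  then show ?case using ge2 by simp
qed (simp_all add: orbit_Suc)

text \<open>The orbit closes up after \<open>n\<close> steps: its entries at \<open>n\<close> and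
  \<open>Suc n\<close> are \<open>x\<close> and \<open>\<sigma> x\<close>.\<close>

lemma root_monodromy:
  assumes "x \<in> roots"
  shows "(X 1 0 n - 1) * x + X 0 1 n * \<sigma> x = 0"
    and "X 1 0 (Suc n) * x + (X 0 1 (Suc n) - 1) * \<sigma> x = 0"
  using lin_rec_root [OF assms, of n] lin_rec_root [OF assms, of "Suc n"]
    lin_rec_linear [of _ _ x "\<sigma> x" n] lin_rec_linear [of _ _ x "\<sigma> x" "Suc n"]
  by (simp_all add: orbit_Suc algebra_simps del: lin_rec.simps)

text \<open>
  Descent: averaging the monodromy-invariant vector \<open>(v, w)\<close>, scaled by a suitable \<open>y\<close>, over the
  semilinear action of the Galois group yields a root outside a given hyperplane.
\<close>

lemma root_of_invariant:
  assumes "X v w n = v" "X v w (Suc n) = w" "k * v + l * w \<noteq> 0"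
  shows "\<exists>z\<in>roots. k * z + l * \<sigma> z \<noteq> 0"
proof -
  \<comment> \<open>\<open>?z y 0\<close> is the candidate root. Invariance of \<open>(v, w)\<close>
    provides the periodicity that makes \<open>?z y 1\<close> and \<open>?z y 2\<close> its images
    under \<open>\<sigma>\<close> and its square.\<close>
  let ?z = "\<lambda>y j. \<Sum>i<n. (\<tau> ^^ i) (y * X v w (i + j))"
  have \<sigma>0: "\<sigma> (?z y 0) = ?z y 1" for y
    using \<sigma>_twisted_sum [of "\<lambda>i. y * X v w i"] by (simp add: assms(1))
  have \<sigma>1: "\<sigma> (?z y 1) = ?z y 2" for y
    using \<sigma>_twisted_sum [of "\<lambda>i. y * X v w (Suc i)"] by (simp add: assms(2))
  have rec: "\<alpha> * ?z y 0 + \<beta> * ?z y 1 + ?z y 2 = 0" for y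
  proof -
    \<comment> \<open>\<open>\<tau> ^^ i\<close> turns the \<open>i\<close>-th conjugates of the
      coefficients back into \<open>\<alpha>\<close> and \<open>\<beta>\<close>, so each summand
      vanishes by the recursion.\<close>
    have "\<alpha> * ?z y 0 + \<beta> * ?z y 1 + ?z y 2 =
      (\<Sum>i<n. (\<tau> ^^ i) (orbit \<sigma> \<alpha> i * (y * X v w i) + orbit \<sigma> \<beta> i * (y * X v w (Suc i))
          + y * X v w (Suc (Suc i))))"
      by (simp add: funpow_\<tau>_hom sum.distrib sum_distrib_left orbit_def funpow_\<tau>_\<sigma>
          del: lin_rec.simps)
    also have "\<dots> = (\<Sum>i<n. (\<tau> ^^ i) 0)"
      by (rule sum.cong) (simp_all add: algebra_simps)
    also have "\<dots> = 0"
      by (simp add: funpow_\<tau>_0)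
    finally show ?thesis .
  qed
  have root: "?z y 0 \<in> roots" for y
    using rec [of y] by (simp only: mem_Collect_eq \<sigma>0 \<sigma>1)
  show ?thesis
  proof (rule ccontr)
    assume none: "\<not> ?thesis"
    have zero: "k * ?z y 0 + l * ?z y 1 = 0" for y
    proof -
      have "k * ?z y 0 + l * \<sigma> (?z y 0) = 0"
        using none root [of y] by blast
      then show ?thesis by (simp only: \<sigma>0)
    qed
    \<comment> \<open>If every root lay in the hyperplane, the \<open>d i\<close> would be the
      coefficients of a relation among the characters \<open>\<tau> ^^ i\<close>, while
      \<open>d 0 = k * v + l * w\<close> is nonzero.\<close>
    define d where "d i = k * (\<tau> ^^ i) (X v w i) + l * (\<tau> ^^ i) (X v w (Suc i))" for i
    have "d 0 = 0"
    proof (rule Dedekind_independence [OF finite_lessThan inj_on_funpow_\<tau>])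
      fix y
      have "(\<Sum>i<n. d i * (\<tau> ^^ i) y) = k * ?z y 0 + l * ?z y 1"
        by (simp add: d_def funpow_\<tau>_hom sum.distrib sum_distrib_left algebra_simps
            del: lin_rec.simps)
      with zero show "(\<Sum>i<n. d i * (\<tau> ^^ i) y) = 0" by simp
    qed (use n in \<open>auto simp: funpow_\<tau>_hom\<close>)
    with assms(3) show False by (simp add: d_def)
  qed
qed

text \<open>By periodicity the last recursion step of \<open>\<sigma> (g n)\<close> has coefficients
  \<open>\<beta>\<close> and \<open>\<alpha>\<close>. So
  \<open>\<sigma> (g n) + \<beta> * \<sigma> (g (n - 1))\<close> is the upper left entry of
  \<open>M\<close>.\<close>

lemma monodromy_trace: "X 1 0 n + X 0 1 (Suc n) = g n + \<sigma> (g n) + \<beta> * \<sigma> (g (n - 1))"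
proof -
  obtain m where m: "n = Suc (Suc m)" using n by (metis Suc_le_D numeral_2_eq_2 Suc_le_mono)
  have hom: "\<sigma> (g k) = cleared_G (conj_shift (orbit \<sigma> \<alpha>)) (conj_shift (orbit \<sigma> \<beta>)) k" for k
    by (subst cleared_G_hom [where h = \<sigma>])
      (simp_all add: one mult diff uminus conj_shift_def orbit_Suc)
  then have "\<sigma> (g n) = - \<beta> * \<sigma> (g (n - 1)) - \<alpha> * \<sigma> (g m)"
    using orbit_period [of \<alpha>] orbit_period [of \<beta>] unfolding hom
    by (simp add: m conj_shift_def)
  moreover have "X 1 0 n = - \<alpha> * \<sigma> (g m)"
    by (simp only: m lin_rec_1_0 hom orbit_0)
  ultimately show ?thesis
    by (simp only: lin_rec_0_1) simp
qed

text \<open>This is \<open>det (M - 1) = 1 - tr M + det M\<close>, with \<open>det M\<close> from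
  the Casoratian.\<close>

lemma monodromy_det:
  "1 - (g n + \<sigma> (g n) + \<beta> * \<sigma> (g (n - 1))) + conj_prod (orbit \<sigma> \<alpha>) n =
    (X 1 0 n - 1) * (X 0 1 (Suc n) - 1) - X 0 1 n * X 1 0 (Suc n)"
  using lin_rec_Casoratian [of "orbit \<sigma> \<alpha>" "orbit \<sigma> \<beta>" n]
  unfolding monodromy_trace [symmetric] by (simp add: algebra_simps del: lin_rec.simps)

text \<open>The right column of \<open>M\<close> is \<open>g (n - 1)\<close>, \<open>g n\<close>.
  The lower left entry is a multiple of \<open>\<sigma> (g (n - 1))\<close>, and the trace formula
  determines the remaining entry.\<close>

lemma monodromy_eq_id_iff:
  "g (n - 1) = 0 \<and> g n = 1 \<longleftrightarrow>
    X 1 0 n = 1 \<and> X 0 1 n = 0 \<and> X 1 0 (Suc n) = 0 \<and> X 0 1 (Suc n) = 1"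
proof -
  have n': "Suc (n - 1) = n" using n by simp
  have "X 0 1 n = g (n - 1)" "X 0 1 (Suc n) = g n"
    using lin_rec_0_1 [of _ _ "n - 1"] unfolding n' by (simp_all only: lin_rec_0_1)
  moreover have "X 1 0 (Suc n) = - \<alpha> * \<sigma> (g (n - 1))"
    using lin_rec_1_0 [of "orbit \<sigma> \<alpha>" "orbit \<sigma> \<beta>" "n - 1"] unfolding n'
    by (subst cleared_G_hom [where h = \<sigma>])
      (simp_all add: one mult diff uminus conj_shift_def orbit_Suc)
  ultimately show ?thesis
    using monodromy_trace by (auto simp: zero one simp del: lin_rec.simps)
qed

section \<open>Counting the roots by the rank of \<open>M - 1\<close>\<close>

lemma card_roots_trivial:
  assumes "(X 1 0 n - 1) * (X 0 1 (Suc n) - 1) - X 0 1 n * X 1 0 (Suc n) \<noteq> 0"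
  shows "card roots = 1"
proof -
  have "x = 0" if "x \<in> roots" for x
    by (rule kernel_2x2_trivial [OF assms root_monodromy [OF that]])
  moreover have "0 \<in> roots" by (simp add: zero)
  ultimately have "roots = {0}" by blast
  then show ?thesis by simp
qed

text \<open>Descent provides a nonzero root \<open>r\<close>. For any root \<open>x\<close> the
  kernel vectors \<open>(x, \<sigma> x)\<close> and \<open>(r, \<sigma> r)\<close> are parallel, so
  \<open>x / r\<close> is fixed by \<open>\<sigma>\<close>.\<close>

lemma card_roots_line:
  assumes det: "(X 1 0 n - 1) * (X 0 1 (Suc n) - 1) - X 0 1 n * X 1 0 (Suc n) = 0"
    and "X 1 0 n - 1 \<noteq> 0 \<or> X 0 1 n \<noteq> 0 \<or> X 1 0 (Suc n) \<noteq> 0 \<or> X 0 1 (Suc n) - 1 \<noteq> 0"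
  shows "card roots = q"
proof -
  obtain v w where vw: "v \<noteq> 0 \<or> w \<noteq> 0" "(X 1 0 n - 1) * v + X 0 1 n * w = 0"
    "X 1 0 (Suc n) * v + (X 0 1 (Suc n) - 1) * w = 0"
    using singular_2x2_kernel [OF iffD1 [OF right_minus_eq det]] by blast
  have inv: "X v w n = v" "X v w (Suc n) = w"
    using vw(2,3) lin_rec_linear [of _ _ v w n] lin_rec_linear [of _ _ v w "Suc n"]
    by (simp_all add: algebra_simps del: lin_rec.simps)
  \<comment> \<open>The functional is the coordinate at which \<open>(v, w)\<close> is nonzero; a
    root with \<open>\<sigma> r \<noteq> 0\<close> is itself nonzero.\<close>
  have "\<exists>r\<in>roots. r \<noteq> 0"
    using vw(1) root_of_invariant [OF inv, of 1 0] root_of_invariant [OF inv, of 0 1]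
    by (auto simp: eq_0_iff)
  then obtain r where r: "r \<in> roots" "r \<noteq> 0" by blast
  have "bij_betw (\<lambda>k. k * r) {k. \<sigma> k = k} roots"
  proof (rule bij_betw_byWitness [where f' = "\<lambda>x. x / r"])
    show "(\<lambda>k. k * r) ` {k. \<sigma> k = k} \<subseteq> roots"
    proof clarify
      fix k
      assume "\<sigma> k = k"
      then have "\<alpha> * (k * r) + \<beta> * \<sigma> (k * r) + \<sigma> (\<sigma> (k * r)) =
          k * (\<alpha> * r + \<beta> * \<sigma> r + \<sigma> (\<sigma> r))"
        by (simp add: mult algebra_simps)
      then show "\<alpha> * (k * r) + \<beta> * \<sigma> (k * r) + \<sigma> (\<sigma> (k * r)) = 0" using r(1) by simp
    qed
    show "(\<lambda>x. x / r) ` roots \<subseteq> {k. \<sigma> k = k}"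
    proof (rule image_subsetI)
      fix x
      assume x: "x \<in> roots"
      have "x * \<sigma> r = r * \<sigma> x"
        by (rule kernel_2x2_parallel [OF assms(2)]) (rule root_monodromy x r(1))+
      then show "x / r \<in> {k. \<sigma> k = k}"
        using r(2) by (simp add: divide eq_0_iff field_simps)
    qed
  qed (use r(2) in auto)
  from bij_betw_same_card [OF this] show ?thesis by (simp only: card_fixed)
qed

text \<open>Since \<open>\<sigma>\<close> multiplies every such determinant by the same
  \<open>\<alpha>\<close>, their quotients are fixed by \<open>\<sigma>\<close> when
  \<open>\<alpha>\<close> is nonzero.\<close>

lemma \<sigma>_root_Wronskian:
  assumes "x \<in> roots" "y \<in> roots"
  shows "\<sigma> (x * \<sigma> y - y * \<sigma> x) = \<alpha> * (x * \<sigma> y - y * \<sigma> x)"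
  by (simp only: diff mult \<sigma>_\<sigma>_root [OF assms(1)] \<sigma>_\<sigma>_root [OF assms(2)])
    (simp add: algebra_simps)

lemma card_roots_plane:
  assumes "\<alpha> \<noteq> 0"
    and "X 1 0 n = 1" "X 0 1 n = 0" "X 1 0 (Suc n) = 0" "X 0 1 (Suc n) = 1"
  shows "card roots = q ^ 2"
proof -
  obtain r where r: "r \<in> roots" "r \<noteq> 0"
    using root_of_invariant [of 1 0 1 0] assms by auto
  \<comment> \<open>The functional vanishes on \<open>(r, \<sigma> r)\<close> and takes the value
    \<open>r\<close> at the invariant vector \<open>(0, 1)\<close>. Avoiding its kernel makes
    \<open>r\<close> and \<open>s\<close> independent.\<close>
  obtain s where s: "s \<in> roots" "- \<sigma> r * s + r * \<sigma> s \<noteq> 0"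
    using root_of_invariant [of 0 1 "- \<sigma> r" r] assms r(2) by auto
  define \<Delta> where "\<Delta> = r * \<sigma> s - s * \<sigma> r"
  have \<Delta>: "\<Delta> \<noteq> 0" using s(2) by (simp add: \<Delta>_def algebra_simps)
  let ?F = "{k. \<sigma> k = k}"
  \<comment> \<open>The inverse map is Cramer's rule for the coordinates of
    \<open>(x, \<sigma> x)\<close> with respect to \<open>(r, \<sigma> r)\<close> and
    \<open>(s, \<sigma> s)\<close>.\<close>
  have "bij_betw (\<lambda>(k, l). k * r + l * s) (?F \<times> ?F) roots"
  proof (rule bij_betw_byWitness [where
        f' = "\<lambda>x. ((x * \<sigma> s - s * \<sigma> x) / \<Delta>, (r * \<sigma> x - x * \<sigma> r) / \<Delta>)"])
    show "\<forall>kl\<in>?F \<times> ?F. (((case kl of (k, l) \<Rightarrow> k * r + l * s) * \<sigma> s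
          - s * \<sigma> (case kl of (k, l) \<Rightarrow> k * r + l * s)) / \<Delta>,
        (r * \<sigma> (case kl of (k, l) \<Rightarrow> k * r + l * s)
          - (case kl of (k, l) \<Rightarrow> k * r + l * s) * \<sigma> r) / \<Delta>) = kl"
    proof clarsimp
      fix k l
      assume "\<sigma> k = k" "\<sigma> l = l"
      then have "(k * r + l * s) * \<sigma> s - s * \<sigma> (k * r + l * s) = k * \<Delta>"
        "r * \<sigma> (k * r + l * s) - (k * r + l * s) * \<sigma> r = l * \<Delta>"
        by (simp_all add: add mult \<Delta>_def algebra_simps)
      then show "((k * r + l * s) * \<sigma> s - s * \<sigma> (k * r + l * s)) / \<Delta> = k \<and>
        (r * \<sigma> (k * r + l * s) - (k * r + l * s) * \<sigma> r) / \<Delta> = l"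
        using \<Delta> by simp
    qed
    have \<Delta>_mult: "x * \<Delta> = (x * \<sigma> s - s * \<sigma> x) * r + (r * \<sigma> x - x * \<sigma> r) * s" for x
      by (simp add: \<Delta>_def algebra_simps)
    show "\<forall>x\<in>roots. (case ((x * \<sigma> s - s * \<sigma> x) / \<Delta>, (r * \<sigma> x - x * \<sigma> r) / \<Delta>) of
        (k, l) \<Rightarrow> k * r + l * s) = x"
      using \<Delta> by (simp add: \<Delta>_mult [symmetric] flip: add_divide_distrib)
    show "(\<lambda>(k, l). k * r + l * s) ` (?F \<times> ?F) \<subseteq> roots"
    proof clarsimp
      fix k l
      assume "\<sigma> k = k" "\<sigma> l = l"
      then have "\<alpha> * (k * r + l * s) + \<beta> * \<sigma> (k * r + l * s) + \<sigma> (\<sigma> (k * r + l * s)) =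
          k * (\<alpha> * r + \<beta> * \<sigma> r + \<sigma> (\<sigma> r)) + l * (\<alpha> * s + \<beta> * \<sigma> s + \<sigma> (\<sigma> s))"
        by (simp add: add mult algebra_simps)
      then show "\<alpha> * (k * r + l * s) + \<beta> * \<sigma> (k * r + l * s) + \<sigma> (\<sigma> (k * r + l * s)) = 0"
        using r(1) s(1) by simp
    qed
    show "(\<lambda>x. ((x * \<sigma> s - s * \<sigma> x) / \<Delta>, (r * \<sigma> x - x * \<sigma> r) / \<Delta>)) ` roots \<subseteq> ?F \<times> ?F"
    proof (rule image_subsetI)
      fix x
      assume x: "x \<in> roots"
      show "((x * \<sigma> s - s * \<sigma> x) / \<Delta>, (r * \<sigma> x - x * \<sigma> r) / \<Delta>) \<in> ?F \<times> ?F"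
        using \<sigma>_root_Wronskian [OF x s(1)] \<sigma>_root_Wronskian [OF r(1) x]
          \<sigma>_root_Wronskian [OF r(1) s(1)] assms(1)
        by (simp add: divide flip: \<Delta>_def)
    qed
  qed
  then have "card roots = card (?F \<times> ?F)" by (rule bij_betw_same_card [symmetric])
  then show ?thesis by (simp add: card_cartesian_product card_fixed power2_eq_square)
qed

end

end

theorem theorem9:
  fixes \<sigma> :: "'a::finite_field \<Rightarrow> 'a" and a b c :: 'a and q n :: nat
  assumes "primepow q" and "n \<ge> 2" and "card (UNIV :: 'a set) = q ^ n"
    and "generates_Gal q \<sigma>"
    and "a \<noteq> 0" and "c \<noteq> 0"
  shows
    "let R = {x. a * x + b * \<sigma> x + c * \<sigma> (\<sigma> x) = 0};
         u = formal_u \<sigma> n a c;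
         \<beta> = formal_b_over_c \<sigma> n c;
         u\<sigma> = conj_shift u;
         D = 1 - cleared_value \<sigma> b (conj_prod \<beta> n * (G u n + G u\<sigma> n + G u\<sigma> (n - 1)))
               + conj_prod (orbit \<sigma> (a / c)) n;
         full = (cleared_value \<sigma> b (conj_prod \<beta> (n - 1) * G u (n - 1)) = 0 \<and>
                 cleared_value \<sigma> b (conj_prod \<beta> n * G u n) = 1)
     in (card R = q ^ 2 \<longleftrightarrow> full) \<and>
        (card R = q \<longleftrightarrow> D = 0 \<and> \<not> full) \<and>
        (card R = 1 \<longleftrightarrow> D \<noteq> 0)"
proof -
  interpret cyclic_finite_ext \<sigma> q n
    by unfold_locales (fact assms)+
  let ?R = "{x. a / c * x + b / c * \<sigma> x + \<sigma> (\<sigma> x) = 0}"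
  let ?X = "lin_rec (orbit \<sigma> (a / c)) (orbit \<sigma> (b / c))"
  have R: "{x. a * x + b * \<sigma> x + c * \<sigma> (\<sigma> x) = 0} = ?R"
    using \<open>c \<noteq> 0\<close> by (auto simp: field_simps)
  \<comment> \<open>\<open>id\<close> says \<open>M = 1\<close>, and \<open>d\<close> below is
    \<open>det (M - 1)\<close>.\<close>
  define id where "id \<longleftrightarrow> ?X 1 0 n = 1 \<and> ?X 0 1 n = 0 \<and> ?X 1 0 (Suc n) = 0 \<and> ?X 0 1 (Suc n) = 1"
  define d where "d = (?X 1 0 n - 1) * (?X 0 1 (Suc n) - 1) - ?X 0 1 n * ?X 1 0 (Suc n)"
  have "card ?R = q ^ 2" if id
    using card_roots_plane [of "a / c" "b / c"] that assms(5,6) by (simp add: id_def del: lin_rec.simps)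
  moreover have "card ?R = q" if "d = 0" "\<not> id"
    using card_roots_line [of "a / c" "b / c"] that unfolding id_def d_def by auto
  moreover have "card ?R = 1" if "d \<noteq> 0"
    using card_roots_trivial [of "a / c" "b / c"] that unfolding d_def by auto
  moreover have "d = 0" if id
    using that unfolding id_def d_def by simp
  moreover have "q ^ 2 \<noteq> q" "q ^ 2 \<noteq> 1" "q \<noteq> 1"
    using q_gt_1 by (auto simp: power2_eq_square)
  \<comment> \<open>The cases \<open>id\<close>, \<open>d = 0\<close> without \<open>id\<close>, and
    \<open>d \<noteq> 0\<close> are exhaustive and the three cardinalities distinct, so the
    implications become equivalences.\<close>
  ultimately have "(card ?R = q ^ 2 \<longleftrightarrow> id) \<and> (card ?R = q \<longleftrightarrow> d = 0 \<and> \<not> id) \<and>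
      (card ?R = 1 \<longleftrightarrow> d \<noteq> 0)"
    by metis
  then show ?thesis
    unfolding Let_def R cleared_value_G [OF \<open>c \<noteq> 0\<close>] cleared_value_G_sum [OF \<open>c \<noteq> 0\<close>]
      monodromy_det monodromy_eq_id_iff id_def d_def .
qed

end
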